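(* Let $p$ be a prime, let $k\ge 1$ be an integer, and let $1\le\alpha_1\le\alpha_2\le\dots\le\alpha_k$ be integers. The number of maximal subgroups of $\mathbb{Z}_{p^{\alpha_1}}\times\mathbb{Z}_{p^{\alpha_2}}\times\cdots\times\mathbb{Z}_{p^{\alpha_k}}$ is $$\frac{p^k-1}{p-1}.$$
   Context: $\mathbb{Z}_m$ denotes the cyclic group of order $m$. *)

theory Defs
  imports "HOL-Algebra.Algebra" "HOL-Computational_Algebra.Primes"
begin

definition maximal_subgroup :: "'a set \<Rightarrow> ('a, 'b) monoid_scheme \<Rightarrow> bool" where
  "maximal_subgroup M G \<longleftrightarrow>
     subgroup M G \<and> M \<noteq> carrier G \<and>
     (\<forall>H. subgroup H G \<and> M \<subseteq> H \<longrightarrow> H = M \<or> H = carrier G)"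

end

theory Submission
  imports Defs
begin

text \<open>
  Write \<open>G\<close> for the product group. Its maximal subgroups are exactly the hyperplanes
  \<open>{x \<in> G. p dvd (\<Sum>i. c i * x i)}\<close>, where \<open>c\<close> runs over the nonzero vectors
  with entries in \<open>{0..<p}\<close>; such a congruence makes sense on \<open>G\<close> because \<open>p\<close>
  divides every modulus \<open>p ^ \<alpha> i\<close>.

  A hyperplane is maximal because the pairing with \<open>c\<close> takes values in the field of \<open>p\<close>
  elements: any \<open>y\<close> outside the hyperplane generates \<open>G\<close> together with it
  (\<open>maximal_hyperplane\<close>). Conversely, let \<open>M\<close> be maximal. Then \<open>M\<close> contains all
  multiples of \<open>p\<close> (\<open>p_multiples_in_maximal_subgroup\<close>): otherwise, for some \<open>x\<close>,
  \<open>M\<close> and \<open>p * x\<close> generate \<open>G\<close>, so \<open>(1 - t * p) * x \<in> M\<close> for some \<open>t\<close>; as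
  \<open>1 - t * p\<close> is invertible modulo the exponent of \<open>G\<close>, this gives \<open>x \<in> M\<close>. Now
  choose \<open>g\<close> outside \<open>M\<close>. Each unit vector is congruent modulo \<open>M\<close> to a multiple
  \<open>c j * g\<close>, and \<open>c\<close> is the vector of coefficients sought
  (\<open>maximal_subgroup_is_hyperplane\<close>).

  Finally, two nonzero vectors define the same hyperplane iff they are proportional modulo
  \<open>p\<close>, so each hyperplane arises from exactly \<open>p - 1\<close> of the \<open>p ^ k - 1\<close> nonzero
  vectors (\<open>fiber_hyperplane\<close>).
\<close>

section \<open>Integer vectors as representatives of group elements\<close>

lemma bezout_not_dvd_prime:
  fixes p :: nat and a :: int
  assumes "Factorial_Ring.prime p" and "\<not> int p dvd a"
  obtains u v where "u * a + v * int p = 1"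
proof -
  have "coprime a (int p)"
    using assms prime_imp_coprime[of "int p" a] by (simp add: coprime_commute)
  with bezout_int[of a "int p"] that show thesis
    by (auto simp: coprime_iff_gcd_eq_1)
qed

lemma dvd_sum_cong:
  fixes f g :: "'a \<Rightarrow> int"
  assumes "\<And>i. i \<in> A \<Longrightarrow> f i mod m = g i mod m"
  shows "m dvd sum f A \<longleftrightarrow> m dvd sum g A"
proof -
  have "sum f A mod m = (\<Sum>i\<in>A. f i mod m) mod m"
    by (simp add: mod_sum_eq)
  also have "\<dots> = (\<Sum>i\<in>A. g i mod m) mod m"
    using assms by simp
  also have "\<dots> = sum g A mod m"
    by (simp add: mod_sum_eq)
  finally show ?thesis
    by (simp add: dvd_eq_mod_eq_0)
qed

text \<open>
  A finite product of nontrivial cyclic \<open>p\<close>-groups, over an arbitrary finite index set and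
  without any ordering of the exponents.
\<close>

locale abelian_p_group_product =
  fixes p :: nat and I :: "'i set" and \<alpha> :: "'i \<Rightarrow> nat"
  assumes prime_p: "Factorial_Ring.prime p"
    and finite_I: "finite I"
    and exponent_pos: "i \<in> I \<Longrightarrow> 1 \<le> \<alpha> i"
begin

abbreviation G :: "('i \<Rightarrow> int) monoid" where
  "G \<equiv> product_group I (\<lambda>i. integer_mod_group (p ^ \<alpha> i))"

text \<open>
  The canonical projection from integer vectors onto \<open>G\<close>: entries are reduced modulo the
  moduli, and the result is extended by \<open>undefined\<close> outside \<open>I\<close>, as the carrier
  demands. Subgroups of \<open>G\<close> are handled through their preimages under \<open>red\<close>, where
  integer linear combinations can be formed without reducing.
\<close>

definition red :: "('i \<Rightarrow> int) \<Rightarrow> 'i \<Rightarrow> int" where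
  "red x = (\<lambda>i\<in>I. x i mod int (p ^ \<alpha> i))"

text \<open>The standard bilinear form on integer vectors indexed by \<open>I\<close>.\<close>

definition pairing :: "('i \<Rightarrow> int) \<Rightarrow> ('i \<Rightarrow> int) \<Rightarrow> int" where
  "pairing c x = (\<Sum>i\<in>I. c i * x i)"

text \<open>
  The kernel of the homomorphism from \<open>G\<close> to the integers modulo \<open>p\<close> with coefficient
  vector \<open>c\<close>. For \<open>c\<close> divisible by \<open>p\<close> this is all of \<open>G\<close>.
\<close>

definition hyperplane :: "('i \<Rightarrow> int) \<Rightarrow> ('i \<Rightarrow> int) set" where
  "hyperplane c = {x \<in> carrier G. int p dvd pairing c x}"

text \<open>The nonzero coefficient vectors modulo \<open>p\<close>, each given by its reduced representative.\<close>

definition covectors :: "('i \<Rightarrow> int) set" where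
  "covectors = (\<Pi>\<^sub>E i\<in>I. {0..<int p}) - {\<lambda>i\<in>I. 0}"

lemma p_gt_1: "1 < p"
  using prime_p by (rule prime_gt_1_nat)

lemma p_dvd_modulus: "i \<in> I \<Longrightarrow> int p dvd int (p ^ \<alpha> i)"
  using exponent_pos[of i] by (simp add: dvd_power)

lemma carrier_G: "carrier G = (\<Pi>\<^sub>E i\<in>I. {0..<int (p ^ \<alpha> i)})"
  using p_gt_1 by (simp add: carrier_integer_mod_group)

lemma red_in_carrier [simp]: "red x \<in> carrier G"
  using p_gt_1 unfolding carrier_G red_def by auto

lemma red_carrier: "x \<in> carrier G \<Longrightarrow> red x = x"
  unfolding carrier_G red_def by (auto simp: fun_eq_iff PiE_iff extensional_def)

lemma red_cong:
  assumes "\<And>i. i \<in> I \<Longrightarrow> x i mod int (p ^ \<alpha> i) = y i mod int (p ^ \<alpha> i)"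
  shows "red x = red y"
  using assms by (auto simp: red_def)

lemma one_G: "\<one>\<^bsub>G\<^esub> = red (\<lambda>i. 0)"
  by (auto simp: red_def)

lemma mult_red: "red x \<otimes>\<^bsub>G\<^esub> red y = red (\<lambda>i. x i + y i)"
  by (auto simp: red_def mod_add_eq)

lemma inv_red: "inv\<^bsub>G\<^esub> (red x) = red (\<lambda>i. - x i)"
proof -
  have "inv\<^bsub>G\<^esub> (red x) = (\<lambda>i\<in>I. inv\<^bsub>integer_mod_group (p ^ \<alpha> i)\<^esub> (red x i))"
    by (rule inv_product_group) (use red_in_carrier[of x] in auto)
  also have "\<dots> = red (\<lambda>i. - x i)"
    using p_gt_1 by (auto simp: red_def carrier_integer_mod_group mod_minus_eq)
  finally show ?thesis .
qed

lemma subgroup_red_scale: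
  assumes M: "subgroup M G" and x: "red x \<in> M"
  shows "red (\<lambda>i. s * x i) \<in> M"
proof -
  have nonneg: "red (\<lambda>i. int n * x i) \<in> M" for n
  proof (induction n)
    case 0
    show ?case
      using subgroup.one_closed[OF M] unfolding one_G by simp
  next
    case (Suc n)
    from subgroup.m_closed[OF M x Suc] show ?case
      unfolding mult_red by (simp add: algebra_simps)
  qed
  show ?thesis
  proof (cases s rule: int_cases2)
    case (nonneg n)
    with \<open>red (\<lambda>i. int n * x i) \<in> M\<close> show ?thesis by simp
  next
    case (nonpos n)
    with subgroup.m_inv_closed[OF M nonneg[of n]] show ?thesis
      unfolding inv_red by simp
  qed
qed

lemma subgroup_red_add:
  assumes "subgroup M G" and "red x \<in> M" and "red y \<in> M"
  shows "red (\<lambda>i. x i + y i) \<in> M"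
  using subgroup.m_closed[OF assms] unfolding mult_red .

lemma subgroup_red_combination:
  assumes "subgroup M G" and "red x \<in> M" and "red y \<in> M"
  shows "red (\<lambda>i. s * x i + t * y i) \<in> M"
  using subgroup_red_add[OF assms(1) subgroup_red_scale[OF assms(1,2)] subgroup_red_scale[OF assms(1,3)]] .

lemma subgroup_red_sum:
  assumes "subgroup M G" and "finite J" and "\<And>j. j \<in> J \<Longrightarrow> red (f j) \<in> M"
  shows "red (\<lambda>i. \<Sum>j\<in>J. f j i) \<in> M"
  using assms(2,3)
proof (induction J)
  case empty
  show ?case
    using subgroup.one_closed[OF assms(1)] unfolding one_G by simp
next
  case (insert j J)
  then have "red (f j) \<in> M" and "red (\<lambda>i. \<Sum>j\<in>J. f j i) \<in> M"
    by auto
  from subgroup_red_add[OF assms(1) this] insert.hyps show ?case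
    by simp
qed

text \<open>A subset of \<open>G\<close> is a subgroup if its preimage under \<open>red\<close> is an additive subgroup.\<close>

lemma subgroup_redI:
  assumes "M \<subseteq> carrier G" and "red (\<lambda>i. 0) \<in> M"
    and "\<And>x y. red x \<in> M \<Longrightarrow> red y \<in> M \<Longrightarrow> red (\<lambda>i. x i + y i) \<in> M"
    and "\<And>x. red x \<in> M \<Longrightarrow> red (\<lambda>i. - x i) \<in> M"
  shows "subgroup M G"
proof
  show "M \<subseteq> carrier G" by fact
  show "\<one>\<^bsub>G\<^esub> \<in> M" unfolding one_G by fact
  have eq: "red x = x" if "x \<in> M" for x
    using red_carrier assms(1) that by blast
  show "x \<otimes>\<^bsub>G\<^esub> y \<in> M" if "x \<in> M" "y \<in> M" for x y
    using assms(3)[of x y] mult_red[of x y] eq[OF that(1)] eq[OF that(2)] that by simp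
  show "inv\<^bsub>G\<^esub> x \<in> M" if "x \<in> M" for x
    using assms(4)[of x] inv_red[of x] eq[OF that] that by simp
qed

section \<open>Hyperplanes are maximal subgroups\<close>

lemma pairing_add: "pairing c (\<lambda>i. x i + y i) = pairing c x + pairing c y"
  by (simp add: pairing_def algebra_simps sum.distrib)

lemma pairing_scale: "pairing c (\<lambda>i. s * x i) = s * pairing c x"
  by (simp add: pairing_def sum_distrib_left algebra_simps)

text \<open>
  The pairing modulo \<open>p\<close> descends to \<open>G\<close>, since \<open>p\<close> divides every modulus.
\<close>

lemma dvd_pairing_red: "int p dvd pairing c (red x) \<longleftrightarrow> int p dvd pairing c x"
  unfolding pairing_def
proof (rule dvd_sum_cong)
  fix i assume i: "i \<in> I"
  then have "red x i mod int p = x i mod int p"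
    using p_dvd_modulus[OF i] by (simp add: red_def mod_mod_cancel del: of_nat_power)
  then show "c i * red x i mod int p = c i * x i mod int p"
    by (metis mod_mult_right_eq)
qed

lemma red_in_hyperplane: "red x \<in> hyperplane c \<longleftrightarrow> int p dvd pairing c x"
  unfolding hyperplane_def by (simp only: mem_Collect_eq red_in_carrier simp_thms dvd_pairing_red)

lemma pairing_unit: "j \<in> I \<Longrightarrow> pairing c (\<lambda>i. of_bool (i = j)) = c j"
  using finite_I by (simp add: pairing_def of_bool_def if_distrib cong: if_cong)

lemma subgroup_hyperplane: "subgroup (hyperplane c) G"
proof (rule subgroup_redI)
  show "hyperplane c \<subseteq> carrier G"
    by (auto simp: hyperplane_def)
qed (use pairing_scale[of c "-1"] in \<open>auto simp: red_in_hyperplane pairing_add\<close>, simp add: pairing_def)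

lemma covectorE:
  assumes "c \<in> covectors"
  obtains j where "j \<in> I" and "\<not> int p dvd c j"
proof -
  from assms have c: "c \<in> (\<Pi>\<^sub>E i\<in>I. {0..<int p})" and nz: "c \<noteq> (\<lambda>i\<in>I. 0)"
    by (auto simp: covectors_def)
  have "\<exists>j\<in>I. c j \<noteq> 0"
  proof (rule ccontr)
    assume "\<not> (\<exists>j\<in>I. c j \<noteq> 0)"
    with c have "c = (\<lambda>i\<in>I. 0)"
      by (auto simp: PiE_iff extensional_def fun_eq_iff)
    with nz show False ..
  qed
  with c obtain j where j: "j \<in> I" "c j \<noteq> 0" "0 \<le> c j" "c j < int p"
    by (auto simp: PiE_iff)
  then show thesis
    using that zdvd_not_zless[of "c j" "int p"] by fastforce
qed

lemma maximal_hyperplane: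
  assumes "c \<in> covectors"
  shows "maximal_subgroup (hyperplane c) G"
  unfolding maximal_subgroup_def
proof (intro conjI allI impI)
  show "subgroup (hyperplane c) G"
    by (rule subgroup_hyperplane)
  obtain j where "j \<in> I" "\<not> int p dvd c j"
    using covectorE[OF assms] .
  then have "red (\<lambda>i. of_bool (i = j)) \<notin> hyperplane c"
    unfolding red_in_hyperplane by (simp add: pairing_unit)
  then show "hyperplane c \<noteq> carrier G"
    using red_in_carrier by metis
  fix H
  assume H: "subgroup H G \<and> hyperplane c \<subseteq> H"
  show "H = hyperplane c \<or> H = carrier G"
  proof (cases "H = hyperplane c")
    case False
    have sub: "H \<subseteq> carrier G"
      using H subgroup.subset by blast
    with False H obtain y where y: "y \<in> H" "y \<notin> hyperplane c" "red y = y"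
      using red_carrier by blast
    then have "\<not> int p dvd pairing c y"
      using red_in_hyperplane[of y c] by simp
    then obtain u v where uv: "u * pairing c y + v * int p = 1"
      using bezout_not_dvd_prime prime_p by blast
    have "z \<in> H" if "z \<in> carrier G" for z
    proof -
      define t where "t = pairing c z * u"
      have "pairing c (\<lambda>i. z i + (- t) * y i) = pairing c z * (1 - u * pairing c y)"
        unfolding pairing_add pairing_scale t_def by (simp add: algebra_simps)
      also have "\<dots> = pairing c z * v * int p"
        using uv by (simp add: algebra_simps flip: uv)
      finally have "red (\<lambda>i. z i + (- t) * y i) \<in> hyperplane c"
        by (simp add: red_in_hyperplane)
      then have "red (\<lambda>i. z i + (- t) * y i) \<in> H" "red y \<in> H"
        using H y by auto
      from subgroup_red_combination[OF _ this, of 1 t] H red_carrier[OF that] show ?thesis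
        by simp
    qed
    with sub show ?thesis by blast
  qed simp
qed

section \<open>Maximal subgroups are hyperplanes\<close>

text \<open>
  A maximal subgroup \<open>M\<close> and an element outside it generate \<open>G\<close>: modulo \<open>M\<close>,
  everything is a multiple of \<open>g\<close>.
\<close>

lemma maximal_subgroup_span:
  assumes M: "maximal_subgroup M G" and g: "red g \<notin> M"
  obtains t where "red (\<lambda>i. x i - t * g i) \<in> M"
proof -
  from M have sub: "subgroup M G" by (simp add: maximal_subgroup_def)
  define H where "H = {h \<in> carrier G. \<exists>t. red (\<lambda>i. h i - t * g i) \<in> M}"
  have H_red: "red x \<in> H \<longleftrightarrow> (\<exists>t. red (\<lambda>i. x i - t * g i) \<in> M)" for x
  proof -
    have "red (\<lambda>i. red x i - t * g i) = red (\<lambda>i. x i - t * g i)" for t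
      by (rule red_cong) (simp add: red_def mod_diff_left_eq)
    then show ?thesis
      unfolding H_def by (simp only: mem_Collect_eq red_in_carrier simp_thms)
  qed
  have "M \<subseteq> H"
  proof
    fix x assume "x \<in> M"
    then have "red x = x" using sub red_carrier subgroup.subset by blast
    moreover from this \<open>x \<in> M\<close> have "red (\<lambda>i. x i - 0 * g i) \<in> M" by simp
    ultimately show "x \<in> H" using H_red[of x] by metis
  qed
  moreover have "subgroup H G"
  proof (rule subgroup_redI)
    show "H \<subseteq> carrier G" by (auto simp: H_def)
    show "red (\<lambda>i. 0) \<in> H"
      using \<open>M \<subseteq> H\<close> subgroup.one_closed[OF sub] unfolding one_G by blast
  next
    fix x y assume "red x \<in> H" "red y \<in> H"
    then obtain s t where "red (\<lambda>i. x i - s * g i) \<in> M" "red (\<lambda>i. y i - t * g i) \<in> M"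
      unfolding H_red by blast
    from subgroup_red_add[OF sub this] have "red (\<lambda>i. (x i + y i) - (s + t) * g i) \<in> M"
      by (simp add: algebra_simps)
    then show "red (\<lambda>i. x i + y i) \<in> H"
      unfolding H_red by blast
  next
    fix x assume "red x \<in> H"
    then obtain s where "red (\<lambda>i. x i - s * g i) \<in> M"
      unfolding H_red by blast
    from subgroup_red_scale[OF sub this, of "-1"] have "red (\<lambda>i. - x i - (- s) * g i) \<in> M"
      by (simp add: algebra_simps)
    then show "red (\<lambda>i. - x i) \<in> H"
      unfolding H_red by blast
  qed
  moreover have "red g \<in> H"
    unfolding H_red
    using subgroup.one_closed[OF sub] unfolding one_G by (intro exI[of _ 1]) simp
  ultimately have "H = carrier G"
    using M g unfolding maximal_subgroup_def by blast
  then show thesis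
    using H_red[of x] red_in_carrier[of x] that by blast
qed

text \<open>That is, \<open>M\<close> contains \<open>p G\<close>, which is the Frattini subgroup of \<open>G\<close>.\<close>

lemma p_multiples_in_maximal_subgroup:
  assumes M: "maximal_subgroup M G"
  shows "red (\<lambda>i. int p * x i) \<in> M"
proof (rule ccontr)
  from M have sub: "subgroup M G" by (simp add: maximal_subgroup_def)
  assume notin: "red (\<lambda>i. int p * x i) \<notin> M"
  obtain t where "red (\<lambda>i. x i - t * (int p * x i)) \<in> M"
    using maximal_subgroup_span[OF M notin] .
  then have t: "red (\<lambda>i. (1 - t * int p) * x i) \<in> M"
    by (simp add: algebra_simps)
  \<comment> \<open>Any bound on the exponents would do; \<open>p ^ a\<close> annihilates \<open>G\<close>.\<close>
  define a where "a = sum \<alpha> I"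
  have "red (\<lambda>i. int p ^ a * x i) = red (\<lambda>i. 0)"
  proof (rule red_cong)
    fix i assume "i \<in> I"
    then have "\<alpha> i \<le> a"
      unfolding a_def using finite_I by (intro member_le_sum) auto
    then have "int (p ^ \<alpha> i) dvd int p ^ a"
      by (simp add: le_imp_power_dvd)
    then show "int p ^ a * x i mod int (p ^ \<alpha> i) = 0 mod int (p ^ \<alpha> i)"
      by simp
  qed
  then have a: "red (\<lambda>i. int p ^ a * x i) \<in> M"
    using subgroup.one_closed[OF sub] unfolding one_G by simp
  have "coprime (1 - t * int p) (int p)"
  proof (rule coprimeI)
    fix d assume "d dvd 1 - t * int p" "d dvd int p"
    then have "d dvd (1 - t * int p) + t * int p"
      by (intro dvd_add dvd_mult)
    then show "is_unit d" by simp
  qed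
  then have "coprime (1 - t * int p) (int p ^ a)"
    by simp
  then obtain u v where uv: "u * (1 - t * int p) + v * int p ^ a = 1"
    using bezout_int[of "1 - t * int p" "int p ^ a"] by (auto simp: coprime_iff_gcd_eq_1)
  have "u * ((1 - t * int p) * x i) + v * (int p ^ a * x i) = x i" for i
    using arg_cong[OF uv, of "\<lambda>w. w * x i"] by (simp add: algebra_simps)
  with subgroup_red_combination[OF sub t a, of u v] have "red x \<in> M"
    by simp
  from subgroup_red_scale[OF sub this, of "int p"] notin show False
    by simp
qed

lemma maximal_subgroup_is_hyperplane:
  assumes M: "maximal_subgroup M G"
  obtains c where "c \<in> covectors" and "M = hyperplane c"
proof -
  from M have sub: "subgroup M G" and proper: "M \<noteq> carrier G"
    by (auto simp: maximal_subgroup_def)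
  from proper obtain g where "g \<in> carrier G" "g \<notin> M"
    using subgroup.subset[OF sub] by blast
  then have g: "red g \<notin> M"
    by (simp only: red_carrier simp_thms)
  have "\<exists>t. red (\<lambda>i. of_bool (i = j) - t * g i) \<in> M" for j
    using maximal_subgroup_span[OF M g] by metis
  then obtain t where t: "red (\<lambda>i. of_bool (i = j) - t j * g i) \<in> M" for j
    by metis
  \<comment> \<open>Reducing the coefficients is harmless because \<open>p * g\<close> lies in \<open>M\<close>.\<close>
  define c where "c = (\<lambda>j\<in>I. t j mod int p)"
  have c: "red (\<lambda>i. of_bool (i = j) - c j * g i) \<in> M" if "j \<in> I" for j
  proof -
    have eq: "t j - c j = t j div int p * int p"
      using that by (simp add: c_def minus_mod_eq_div_mult)
    have "of_bool (i = j) - t j * g i + int p * (t j div int p * g i) = of_bool (i = j) - c j * g i" for i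
      using arg_cong[OF eq, of "\<lambda>w. w * g i"] by (simp add: algebra_simps)
    then show ?thesis
      using subgroup_red_add[OF sub t[of j] p_multiples_in_maximal_subgroup[OF M],
          of "\<lambda>i. t j div int p * g i"]
      by (simp only:)
  qed
  \<comment> \<open>Expanding \<open>x\<close> in unit vectors: the pairing gives the coefficient of \<open>g\<close> modulo \<open>M\<close>.\<close>
  have cong: "red (\<lambda>i. x i - pairing c x * g i) \<in> M" for x
  proof -
    have "red (\<lambda>i. \<Sum>j\<in>I. x j * (of_bool (i = j) - c j * g i)) \<in> M"
      using sub finite_I by (rule subgroup_red_sum) (intro subgroup_red_scale[OF sub] c)
    also have "red (\<lambda>i. \<Sum>j\<in>I. x j * (of_bool (i = j) - c j * g i)) = red (\<lambda>i. x i - pairing c x * g i)"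
    proof (rule red_cong)
      fix i assume i: "i \<in> I"
      have "(\<Sum>j\<in>I. x j * (of_bool (i = j) - c j * g i))
          = (\<Sum>j\<in>I. x j * of_bool (i = j)) - (\<Sum>j\<in>I. c j * x j * g i)"
        by (simp add: algebra_simps sum_subtractf)
      also have "(\<Sum>j\<in>I. x j * of_bool (i = j)) = x i"
        using i finite_I by (simp add: of_bool_def if_distrib cong: if_cong)
      also have "(\<Sum>j\<in>I. c j * x j * g i) = pairing c x * g i"
        by (simp add: pairing_def sum_distrib_right)
      finally show "(\<Sum>j\<in>I. x j * (of_bool (i = j) - c j * g i)) mod int (p ^ \<alpha> i)
          = (x i - pairing c x * g i) mod int (p ^ \<alpha> i)"
        by simp
    qed
    finally show ?thesis .
  qed
  have multiple: "red (\<lambda>i. s * g i) \<in> M \<longleftrightarrow> int p dvd s" for s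
  proof
    assume s: "red (\<lambda>i. s * g i) \<in> M"
    show "int p dvd s"
    proof (rule ccontr)
      assume "\<not> int p dvd s"
      then obtain u v where uv: "u * s + v * int p = 1"
        using bezout_not_dvd_prime prime_p by blast
      have "u * (s * g i) + v * (int p * g i) = g i" for i
        using arg_cong[OF uv, of "\<lambda>w. w * g i"] by (simp add: algebra_simps)
      with subgroup_red_combination[OF sub s p_multiples_in_maximal_subgroup[OF M], of u v g] g
      show False by simp
    qed
  next
    assume "int p dvd s"
    then obtain r where "s = int p * r" ..
    then show "red (\<lambda>i. s * g i) \<in> M"
      using p_multiples_in_maximal_subgroup[OF M, of "\<lambda>i. r * g i"] by (simp add: mult.assoc)
  qed
  have "red x \<in> M \<longleftrightarrow> int p dvd pairing c x" for x
  proof -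
    have "red x \<in> M \<longleftrightarrow> red (\<lambda>i. pairing c x * g i) \<in> M"
      using subgroup_red_combination[OF sub _ cong[of x], of "\<lambda>i. pairing c x * g i" 1 1]
        subgroup_red_combination[OF sub _ cong[of x], of x 1 "-1"]
      by auto
    then show ?thesis using multiple by simp
  qed
  then have red_iff: "red x \<in> M \<longleftrightarrow> red x \<in> hyperplane c" for x
    by (simp only: red_in_hyperplane)
  have "hyperplane c \<subseteq> carrier G"
    using subgroup_hyperplane by (rule subgroup.subset)
  then have "x \<in> M \<longleftrightarrow> x \<in> hyperplane c" for x
    using red_iff[of x] red_carrier[of x] subgroup.subset[OF sub] by (cases "x \<in> carrier G") auto
  then have eq: "M = hyperplane c"
    by blast
  have "c \<noteq> (\<lambda>i\<in>I. 0)"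
  proof
    assume "c = (\<lambda>i\<in>I. 0)"
    then have "pairing c x = 0" for x
      by (simp add: pairing_def)
    then have "M = carrier G"
      unfolding eq hyperplane_def by auto
    with proper show False ..
  qed
  then have "c \<in> covectors"
    using p_gt_1 unfolding covectors_def c_def by auto
  with eq that show thesis by blast
qed

section \<open>Counting the hyperplanes\<close>

text \<open>
  Vectors with the same hyperplane have vanishing \<open>2\<times>2\<close> minors modulo \<open>p\<close>, that is, they
  are proportional.
\<close>

lemma hyperplane_eq_minors:
  assumes "hyperplane c = hyperplane d" and "i \<in> I" and "j \<in> I"
  shows "int p dvd c i * d j - c j * d i"
proof -
  \<comment> \<open>This vector pairs to zero with \<open>c\<close>, and pairs with \<open>d\<close> to the minor.\<close>
  define x where "x = (\<lambda>l. c i * of_bool (l = j) + (- c j) * of_bool (l = i))"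
  have x: "pairing e x = c i * e j - c j * e i" for e
    using assms(2,3) unfolding x_def pairing_add pairing_scale by (simp add: pairing_unit)
  have "red x \<in> hyperplane c"
    unfolding red_in_hyperplane x by simp
  then show ?thesis
    unfolding assms(1) red_in_hyperplane x .
qed

text \<open>Scalar multiplication of coefficient vectors modulo \<open>p\<close>, with reduced result.\<close>

definition scale_covector :: "('i \<Rightarrow> int) \<Rightarrow> int \<Rightarrow> 'i \<Rightarrow> int" where
  "scale_covector c t = (\<lambda>i\<in>I. t * c i mod int p)"

text \<open>The vectors defining a given hyperplane are the \<open>p - 1\<close> nonzero multiples of any one of them.\<close>

lemma fiber_hyperplane:
  assumes c: "c \<in> covectors"
  shows "bij_betw (scale_covector c) {1..<int p} {d \<in> covectors. hyperplane d = hyperplane c}"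
proof -
  obtain j where j: "j \<in> I" "\<not> int p dvd c j"
    using covectorE[OF c] .
  obtain u v where uv: "u * c j + v * int p = 1"
    using bezout_not_dvd_prime prime_p j(2) by blast
  have small: "\<not> int p dvd t" if "t \<in> {1..<int p}" for t
    using that zdvd_not_zless[of t "int p"] by auto
  have pairing_scale_covector: "int p dvd pairing (scale_covector c t) x \<longleftrightarrow> int p dvd t * pairing c x"
    for t x
    unfolding pairing_def sum_distrib_left
    by (rule dvd_sum_cong)
      (simp add: scale_covector_def mod_mult_left_eq flip: mult.assoc)
  have prime_int: "Factorial_Ring.prime (int p)"
    using prime_p by simp
  have inj: "inj_on (scale_covector c) {1..<int p}"
  proof (rule inj_onI)
    fix s t
    assume st: "s \<in> {1..<int p}" "t \<in> {1..<int p}" "scale_covector c s = scale_covector c t"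
    from st(3) have "s * c j mod int p = t * c j mod int p"
      using j(1) by (auto simp: scale_covector_def fun_eq_iff dest: spec[of _ j])
    then have "int p dvd (s - t) * c j"
      by (simp add: mod_eq_dvd_iff algebra_simps)
    then have "int p dvd s - t"
      using j(2) prime_int by (simp add: prime_dvd_mult_iff)
    then show "s = t"
      using st(1,2) by (metis atLeastLessThan_iff mod_eq_dvd_iff mod_pos_pos_trivial order_trans zero_le_one)
  qed
  have "scale_covector c t \<in> {d \<in> covectors. hyperplane d = hyperplane c}" if t: "t \<in> {1..<int p}" for t
  proof -
    have "\<not> int p dvd t * c j"
      using j small[OF t] prime_int by (simp add: prime_dvd_mult_iff)
    then have "scale_covector c t j \<noteq> 0"
      using j(1) by (auto simp: scale_covector_def)
    then have "scale_covector c t \<noteq> (\<lambda>i\<in>I. 0)"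
      using j(1) by auto
    moreover have "scale_covector c t \<in> (\<Pi>\<^sub>E i\<in>I. {0..<int p})"
      using p_gt_1 by (auto simp: scale_covector_def)
    ultimately have "scale_covector c t \<in> covectors"
      by (simp add: covectors_def)
    moreover have "hyperplane (scale_covector c t) = hyperplane c"
      unfolding hyperplane_def pairing_scale_covector
      using small[OF t] prime_int by (simp add: prime_dvd_mult_iff)
    ultimately show ?thesis by simp
  qed
  moreover have "d \<in> scale_covector c ` {1..<int p}"
    if d: "d \<in> covectors" and eq: "hyperplane d = hyperplane c" for d
  proof -
    \<comment> \<open>\<open>u\<close> inverts \<open>c j\<close> modulo \<open>p\<close>, so \<open>t\<close> is the ratio of the \<open>j\<close>-th entries.\<close>
    define t where "t = u * d j mod int p"
    have dt: "d i = scale_covector c t i" if i: "i \<in> I" for i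
    proof -
      have "d i - u * d j * c i = u * (c j * d i - c i * d j) + v * d i * int p"
        using arg_cong[OF uv, of "\<lambda>w. w * d i"] by (simp add: algebra_simps)
      also have "int p dvd \<dots>"
        using hyperplane_eq_minors[OF eq[symmetric] j(1) i] by simp
      finally have "d i mod int p = u * d j * c i mod int p"
        by (simp add: mod_eq_dvd_iff)
      moreover have "d i mod int p = d i"
        using d i unfolding covectors_def by (auto simp: PiE_iff)
      ultimately show ?thesis
        using i by (simp add: scale_covector_def t_def mod_mult_left_eq)
    qed
    have "d = scale_covector c t"
      using d dt unfolding covectors_def
      by (auto simp: PiE_iff fun_eq_iff extensional_def scale_covector_def)
    moreover have "t \<noteq> 0"
    proof
      assume "t = 0"
      then have "d = (\<lambda>i\<in>I. 0)"
        using \<open>d = scale_covector c t\<close> by (simp add: scale_covector_def)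
      with d show False by (simp add: covectors_def)
    qed
    moreover have "0 \<le> t" "t < int p"
      using p_gt_1 by (auto simp: t_def)
    ultimately show ?thesis by force
  qed
  ultimately show ?thesis
    using inj unfolding bij_betw_def by blast
qed

lemma card_maximal_subgroups: "card {M. maximal_subgroup M G} * (p - 1) = p ^ card I - 1"
proof -
  have max: "{M. maximal_subgroup M G} = hyperplane ` covectors"
    using maximal_hyperplane maximal_subgroup_is_hyperplane by blast
  have fin: "finite covectors"
    unfolding covectors_def using finite_I by (intro finite_Diff finite_PiE) auto
  have "card covectors = (\<Sum>M\<in>hyperplane ` covectors. card {d \<in> covectors. hyperplane d = M})"
    using sum.image_gen[OF fin, of "\<lambda>_. 1 :: nat" hyperplane] by simp
  also have "\<dots> = (\<Sum>M\<in>hyperplane ` covectors. p - 1)"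
  proof (rule sum.cong)
    fix M assume "M \<in> hyperplane ` covectors"
    then obtain c where "c \<in> covectors" "M = hyperplane c" by blast
    then show "card {d \<in> covectors. hyperplane d = M} = p - 1"
      using bij_betw_same_card[OF fiber_hyperplane[of c]] by auto
  qed simp
  finally have "card covectors = card {M. maximal_subgroup M G} * (p - 1)"
    by (simp add: max)
  moreover have "card covectors = p ^ card I - 1"
    unfolding covectors_def using p_gt_1 finite_I by (subst card_Diff_singleton) (auto simp: card_PiE)
  ultimately show ?thesis by simp
qed

end

theorem proposition3p2:
  fixes p k :: nat and \<alpha> :: "nat \<Rightarrow> nat"
  assumes "Factorial_Ring.prime p"
    and "k \<ge> 1"
    and "1 \<le> \<alpha> 1"
    and "mono_on {1..k} \<alpha>"
  shows "real (card {M. maximal_subgroup M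
            (product_group {1..k} (\<lambda>i. integer_mod_group (p ^ \<alpha> i)))})
         = (real p ^ k - 1) / (real p - 1)"
proof -
  have "1 \<le> \<alpha> i" if "i \<in> {1..k}" for i
    using mono_onD[OF assms(4), of 1 i] that assms(2,3) by force
  then interpret abelian_p_group_product p "{1..k}" \<alpha>
    using assms(1) by unfold_locales auto
  have "1 \<le> p" "1 \<le> p ^ k"
    using p_gt_1 by auto
  then have "real (card {M. maximal_subgroup M G}) * (real p - 1) = real p ^ k - 1"
    using arg_cong[OF card_maximal_subgroups, of real] by (simp add: of_nat_diff)
  then show ?thesis
    using p_gt_1 by (simp add: field_simps)
qed

end
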